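(* Let $\beta>1$ and $f_\beta:\mathbb{R}\to\mathbb{R}$, $f_\beta(x)=\sum_{l=0}^\infty 2^{-l\beta}\{2^lx\}$, where $\{x\}=x-[x]-\frac12$. Let $x_0\in\mathbb{R}$. If $x_0$ is not a dyadic rational, then $\overline h_{f_\beta}(x_0)=\beta$; if $x_0$ is a dyadic rational, then $\overline h_{f_\beta}(x_0)=0$.
   Context: $[x]$ denotes the integer part (floor) of $x$. For a locally bounded $f:\mathbb{R}\to\mathbb{R}$, $x_0\in\mathbb{R}$ and $\alpha\ge0$: with $\Delta^1_hf(x)=f(x+h)-f(x)$, $\Delta_h^{n+1}f(x)=\Delta_h^nf(x+h)-\Delta_h^nf(x)$ and $B_h(x_0,r)=\{x:[x,x+([\alpha]+1)h]\subset B(x_0,r)\}$, one writes $f\in I^\alpha(x_0)$ if there are $C,R>0$ with $\sup_{|h|\le r}\|\Delta_h^{[\alpha]+1}f\|_{L^\infty(B_h(x_0,r))}\ge Cr^\alpha$ for all $0<r\le R$. The upper Hölder exponent is $\overline{h}_f(x_0)=\inf\{\alpha\ge 0:f\in I^\alpha(x_0)\}$. *)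

theory Defs
  imports "HOL-Probability.Essential_Supremum"
begin

primrec fin_diff :: "nat \<Rightarrow> real \<Rightarrow> (real \<Rightarrow> real) \<Rightarrow> real \<Rightarrow> real" where
  "fin_diff 0 h f x = f x"
| "fin_diff (Suc n) h f x = fin_diff n h f (x + h) - fin_diff n h f x"

(* The increment h may be negative, hence closed_segment rather than an interval. *)
definition diff_dom :: "nat \<Rightarrow> real \<Rightarrow> real \<Rightarrow> real \<Rightarrow> real set" where
  "diff_dom n h x0 r = {x. closed_segment x (x + real n * h) \<subseteq> ball x0 r}"

(* The value lies in ennreal, so the norm over the empty set is 0 (in ereal, esssup would
   give -\<infinity>). For non-measurable g, esssup is \<infinity>; the intended g are measurable. *)
definition Linfty_norm :: "real set \<Rightarrow> (real \<Rightarrow> real) \<Rightarrow> ennreal" where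
  "Linfty_norm S g = esssup (restrict_space lebesgue S) (\<lambda>x. ennreal \<bar>g x\<bar>)"

definition irregular_at :: "real \<Rightarrow> real \<Rightarrow> (real \<Rightarrow> real) \<Rightarrow> bool" where
  "irregular_at \<alpha> x0 f \<longleftrightarrow>
     (let n = nat \<lfloor>\<alpha>\<rfloor> + 1 in
      \<exists>C>0. \<exists>R>0. \<forall>r. 0 < r \<and> r \<le> R \<longrightarrow>
        (SUP h\<in>{h. \<bar>h\<bar> \<le> r}. Linfty_norm (diff_dom n h x0 r) (fin_diff n h f))
          \<ge> ennreal (C * r powr \<alpha>))"

(* Extended-real valued, so that the infimum of the empty set is \<infinity>. *)
definition upper_Holder_exponent :: "(real \<Rightarrow> real) \<Rightarrow> real \<Rightarrow> ereal" where
  "upper_Holder_exponent f x0 = (INF \<alpha>\<in>{\<alpha>. 0 \<le> \<alpha> \<and> irregular_at \<alpha> x0 f}. ereal \<alpha>)"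

definition sawtooth :: "real \<Rightarrow> real" where
  "sawtooth x = x - of_int \<lfloor>x\<rfloor> - 1/2"

definition f_saw :: "real \<Rightarrow> real \<Rightarrow> real" where
  "f_saw \<beta> x = (\<Sum>l. 2 powr (- (real l * \<beta>)) * sawtooth (2 ^ l * x))"

definition dyadic_rational :: "real \<Rightarrow> bool" where
  "dyadic_rational x \<longleftrightarrow> (\<exists>(k::int) (n::nat). x = of_int k / 2 ^ n)"

end

theory Submission
  imports Defs
begin

text \<open>At a point \<open>d\<close> with \<open>2 ^ j * d\<close> an integer, \<open>f_saw \<beta>\<close> is right continuous and has a left limit
  exceeding its value by at least \<open>2 powr (- j * \<beta>)\<close>. Finite differences of any order see this jump,
  so a dyadic point is irregular already for \<open>\<alpha> = 0\<close>, and every ball of radius \<open>r\<close>, since it contains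
  some \<open>d\<close> with \<open>2 powr - j\<close> comparable to \<open>r\<close>, gives irregularity for \<open>\<alpha> = \<beta>\<close>. Conversely, if \<open>x0\<close>
  is not dyadic, then infinitely many \<open>j\<close> satisfy \<open>dist (2 ^ j * x0) \<int> \<ge> 1/4\<close>. On the ball of radius
  \<open>r = 2 powr - j / 4\<close> the terms of index at most \<open>j\<close> then sum to an affine function of bounded slope and
  the rest is \<open>O(r powr \<beta>)\<close>. Differences of order at least 2 kill the affine part; for order 1, where
  \<open>\<alpha> < 1\<close>, it contributes \<open>O(r)\<close>. In both cases the differences at these scales are \<open>o(r powr \<alpha>)\<close>
  when \<open>\<alpha> < \<beta>\<close>.\<close>

section \<open>Finite differences\<close>

text \<open>An order \<open>n\<close> difference is a combination of the node values with signed
  binomial coefficients, whose absolute values sum to \<open>2 ^ n\<close>. This lets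
  \<open>f\<close> be replaced by a step or affine model.\<close>

lemma fin_diff_close:
  assumes "\<And>i. i \<le> n \<Longrightarrow> \<bar>f (x + real i * h) - g (x + real i * h)\<bar> \<le> M"
  shows "\<bar>fin_diff n h f x - fin_diff n h g x\<bar> \<le> 2 ^ n * M"
  using assms
proof (induction n arbitrary: x)
  case 0
  show ?case using 0[of 0] by simp
next
  case (Suc n)
  have "\<bar>f (x + h + real i * h) - g (x + h + real i * h)\<bar> \<le> M" if "i \<le> n" for i
    using Suc.prems[of "Suc i"] that by (simp add: algebra_simps)
  then have "\<bar>fin_diff n h f (x + h) - fin_diff n h g (x + h)\<bar> \<le> 2 ^ n * M"
    by (rule Suc.IH)
  moreover have "\<bar>fin_diff n h f x - fin_diff n h g x\<bar> \<le> 2 ^ n * M"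
    using Suc.prems by (intro Suc.IH) auto
  ultimately show ?case by simp
qed

text \<open>The slope survives only in first order, which later separates \<alpha> < 1 from \<alpha>
  \<ge> 1.\<close>

lemma fin_diff_affine: "fin_diff (Suc n) h (\<lambda>x. a * x + b) x = (if n = 0 then a * h else 0)"
proof (induction n arbitrary: x)
  case 0
  show ?case by (simp add: algebra_simps)
next
  case (Suc n)
  show ?case by (subst fin_diff.simps(2)) (simp add: Suc.IH del: fin_diff.simps)
qed

lemma fin_diff_const:
  assumes "\<And>i. i \<le> n \<Longrightarrow> f (x + real i * h) = c"
  shows "fin_diff n h f x = (if n = 0 then c else 0)"
  using assms
proof (induction n arbitrary: x)
  case 0
  show ?case using 0[of 0] by simp
next
  case (Suc n)
  have "f (x + h + real i * h) = c" if "i \<le> n" for i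
    using Suc.prems[of "Suc i"] that by (simp add: algebra_simps)
  then have "fin_diff n h f (x + h) = (if n = 0 then c else 0)"
    by (rule Suc.IH)
  moreover have "fin_diff n h f x = (if n = 0 then c else 0)"
    using Suc.prems by (intro Suc.IH) auto
  ultimately show ?case by simp
qed

text \<open>Only the first node \<open>x\<close> lies left of the jump, and its coefficient is 1 or
  -1. From order 1 on, the difference taken at \<open>x + h\<close> vanishes, so raising the order
  merely flips the sign.\<close>

lemma fin_diff_step:
  assumes "h > 0" "x < d" "d \<le> x + h" "n > 0"
  shows "\<bar>fin_diff n h (\<lambda>y. if y < d then a else b) x\<bar> = \<bar>a - b\<bar>"
proof -
  let ?u = "\<lambda>y. if y < d then a else b"
  have right: "fin_diff n h ?u (x + h) = (if n = 0 then b else 0)" for n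
  proof (rule fin_diff_const)
    fix i :: nat
    have "0 \<le> real i * h" using assms by simp
    then have "d \<le> x + h + real i * h" using assms by linarith
    then show "?u (x + h + real i * h) = b" by simp
  qed
  have "\<bar>fin_diff (Suc m) h ?u x\<bar> = \<bar>a - b\<bar>" for m
  proof (induction m)
    case 0
    show ?case using assms by simp
  next
    case (Suc m)
    then show ?case using right[of "Suc m"] by (metis abs_minus_cancel diff_0 fin_diff.simps(2) nat.distinct(1))
  qed
  then show ?thesis using \<open>n > 0\<close> by (metis Suc_pred)
qed

lemma fin_diff_borel_measurable:
  assumes [measurable]: "f \<in> borel_measurable borel"
  shows "fin_diff n h f \<in> borel_measurable borel"
proof (induction n)
  case 0
  show ?case using assms by (simp add: fin_diff.simps(1)[abs_def])
next
  case (Suc n)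
  note [measurable] = Suc
  show ?case by (simp add: fin_diff.simps(2)[abs_def])
qed

section \<open>Essential suprema on the difference domains\<close>

text \<open>Balls are convex, so only the end nodes matter, whatever the sign of
  \<open>h\<close>.\<close>

lemma diff_dom_eq: "diff_dom n h x0 r = {x. \<bar>x - x0\<bar> < r \<and> \<bar>x + real n * h - x0\<bar> < r}"
proof -
  have "closed_segment x y \<subseteq> ball x0 r \<longleftrightarrow> x \<in> ball x0 r \<and> y \<in> ball x0 r" for x y
    using closed_segment_subset[of x "ball x0 r" y] by auto
  then show ?thesis by (auto simp: diff_dom_def dist_real_def abs_minus_commute)
qed

lemma diff_dom_node:
  assumes "x \<in> diff_dom n h x0 r" "i \<le> n"
  shows "\<bar>x + real i * h - x0\<bar> < r"
proof (cases "0 \<le> h")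
  case True
  then have "0 \<le> real i * h" "real i * h \<le> real n * h"
    using assms(2) by (auto intro: mult_right_mono)
  then show ?thesis using assms(1) unfolding diff_dom_eq mem_Collect_eq by linarith
next
  case False
  then have "real i * h \<le> 0" "real n * h \<le> real i * h"
    using assms(2) by (auto intro: mult_right_mono_neg mult_nonneg_nonpos)
  then show ?thesis using assms(1) unfolding diff_dom_eq mem_Collect_eq by linarith
qed

lemma diff_dom_sets_lebesgue: "diff_dom n h x0 r \<in> sets lebesgue"
proof -
  have "diff_dom n h x0 r \<in> sets borel" unfolding diff_dom_eq by measurable
  then show ?thesis by simp
qed

text \<open>Measurability rules out the default value \<infinity> of \<open>esssup\<close>.\<close>

lemma Linfty_norm_le:
  assumes "g \<in> borel_measurable borel" "\<And>x. x \<in> S \<Longrightarrow> \<bar>g x\<bar> \<le> M"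
  shows "Linfty_norm S g \<le> ennreal M"
  unfolding Linfty_norm_def
proof (rule esssup_I)
  note [measurable] = assms(1)
  have "(\<lambda>x. ennreal \<bar>g x\<bar>) \<in> borel_measurable borel" by measurable
  then have "(\<lambda>x. ennreal \<bar>g x\<bar>) \<in> borel_measurable lebesgue"
    by (simp add: measurable_completion)
  then show "(\<lambda>x. ennreal \<bar>g x\<bar>) \<in> borel_measurable (lebesgue_on S)"
    by (rule measurable_restrict_space1)
  show "AE x in lebesgue_on S. ennreal \<bar>g x\<bar> \<le> ennreal M"
    using assms(2) by (auto simp: space_restrict_space intro!: AE_I2 ennreal_leI)
qed

text \<open>The essential supremum ignores null sets, so the lower bound must hold on an interval of
  positive length.\<close>

lemma Linfty_norm_ge:
  assumes "S \<in> sets lebesgue" "a < b" "{a<..<b} \<subseteq> S" "\<And>x. a < x \<Longrightarrow> x < b \<Longrightarrow> c \<le> \<bar>g x\<bar>"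
  shows "ennreal c \<le> Linfty_norm S g"
proof (rule ccontr)
  assume "\<not> ?thesis"
  then have less: "Linfty_norm S g < ennreal c" by simp
  have "AE x in lebesgue_on S. ennreal \<bar>g x\<bar> \<le> Linfty_norm S g"
    unfolding Linfty_norm_def by (rule esssup_AE)
  then have "AE x in lebesgue. x \<in> S \<longrightarrow> ennreal \<bar>g x\<bar> \<le> Linfty_norm S g"
    using assms(1) by (simp add: AE_restrict_space_iff)
  then have "AE x in lebesgue. x \<notin> {a<..<b}"
  proof (rule AE_mp, intro AE_I2 impI notI)
    fix x assume x: "x \<in> S \<longrightarrow> ennreal \<bar>g x\<bar> \<le> Linfty_norm S g" "x \<in> {a<..<b}"
    then have "ennreal c \<le> Linfty_norm S g"
      using assms(3,4) by (metis ennreal_leI greaterThanLessThan_iff order_trans subsetD)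
    then show False using less by simp
  qed
  then have "emeasure lebesgue {a<..<b} = 0"
    by (subst (asm) AE_iff_measurable[where N = "{a<..<b}"]) auto
  then show False using \<open>a < b\<close> by simp
qed

text \<open>Near a jump, \<open>f\<close> is close to a step function, all of whose finite differences over a short
  step straddling the jump have the size of the jump.\<close>

lemma jump_le_SUP_Linfty_norm:
  assumes L: "(f \<longlongrightarrow> L) (at_left d)" and R: "(f \<longlongrightarrow> f d) (at_right d)"
    and d: "\<bar>d - x0\<bar> < r" and n: "n > 0" and c: "c < \<bar>L - f d\<bar>"
  shows "ennreal c \<le> (SUP h\<in>{h. \<bar>h\<bar> \<le> r}. Linfty_norm (diff_dom n h x0 r) (fin_diff n h f))"
proof -
  \<comment> \<open>The total error \<open>2 ^ n * e\<close> then equals the margin between the jump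
    and \<open>c\<close>.\<close>
  define e where "e = (\<bar>L - f d\<bar> - c) / 2 ^ n"
  have "e > 0" using c by (simp add: e_def)
  from tendstoD[OF L this] obtain u where u: "u < d" "\<And>y. u < y \<Longrightarrow> y < d \<Longrightarrow> \<bar>f y - L\<bar> < e"
    unfolding eventually_at_left_field dist_real_def by auto
  from tendstoD[OF R \<open>e > 0\<close>] obtain v where v: "v > d" "\<And>y. d < y \<Longrightarrow> y < v \<Longrightarrow> \<bar>f y - f d\<bar> < e"
    unfolding eventually_at_right_field dist_real_def by auto
  define m where "m = Min {d - u, v - d, r - \<bar>d - x0\<bar>}"
  have m: "m > 0" "m \<le> d - u" "m \<le> v - d" "m \<le> r - \<bar>d - x0\<bar>"
    using u v d by (simp_all add: m_def)
  \<comment> \<open>Starting less than one step left of \<open>d\<close>, the \<open>n\<close>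
    further steps stay within \<open>h + n * h = m\<close> of \<open>d\<close>.\<close>
  define h where "h = m / real (n + 1)"
  have "h * real (n + 1) = m" by (simp add: h_def)
  then have "h + real n * h = m" by (simp add: algebra_simps)
  moreover have "h > 0" using m by (simp add: h_def)
  ultimately have h: "h > 0" "h + real n * h = m" by auto
  have node: "d - m < x + real i * h \<and> x + real i * h < d + m"
    if "d - h < x" "x < d" "i \<le> n" for x i
  proof -
    have "0 \<le> real i * h" "real i * h \<le> real n * h" "0 \<le> real n * h"
      using h that by (auto intro: mult_right_mono)
    then show ?thesis using that h by linarith
  qed
  have "ennreal c \<le> Linfty_norm (diff_dom n h x0 r) (fin_diff n h f)"
  proof (rule Linfty_norm_ge)
    show "diff_dom n h x0 r \<in> sets lebesgue" by (rule diff_dom_sets_lebesgue)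
    show "d - h < d" using h by simp
    show "{d - h<..<d} \<subseteq> diff_dom n h x0 r"
    proof
      fix x assume "x \<in> {d - h<..<d}"
      then have "d - m < x" "x < d + m" "d - m < x + real n * h" "x + real n * h < d + m"
        using node[of x 0] node[of x n] by simp_all
      then have "\<bar>x - x0\<bar> < r" "\<bar>x + real n * h - x0\<bar> < r"
        using m(4) by linarith+
      then show "x \<in> diff_dom n h x0 r" by (simp add: diff_dom_eq)
    qed
    fix x assume x: "d - h < x" "x < d"
    let ?u = "\<lambda>y. if y < d then L else f d"
    have "\<bar>fin_diff n h f x - fin_diff n h ?u x\<bar> \<le> 2 ^ n * e"
    proof (rule fin_diff_close)
      fix i assume "i \<le> n"
      from node[OF x this] have y: "u < x + real i * h" "x + real i * h < v"
        using m by linarith+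
      show "\<bar>f (x + real i * h) - ?u (x + real i * h)\<bar> \<le> e"
        \<comment> \<open>A node may hit \<open>d\<close> itself, where neither one-sided estimate
          applies but the step function agrees with \<open>f\<close>.\<close>
        using u(2)[OF y(1)] v(2)[OF _ y(2)] \<open>e > 0\<close>
        by (cases "x + real i * h" d rule: linorder_cases) auto
    qed
    moreover have "\<bar>fin_diff n h ?u x\<bar> = \<bar>L - f d\<bar>"
      using x h n by (intro fin_diff_step) auto
    moreover have "2 ^ n * e = \<bar>L - f d\<bar> - c" by (simp add: e_def)
    ultimately show "c \<le> \<bar>fin_diff n h f x\<bar>" by linarith
  qed
  also have "\<dots> \<le> (SUP h\<in>{h. \<bar>h\<bar> \<le> r}. Linfty_norm (diff_dom n h x0 r) (fin_diff n h f))"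
  proof (rule SUP_upper)
    have "0 \<le> real n * h" using h by simp
    then have "\<bar>h\<bar> \<le> r" using h m by linarith
    then show "h \<in> {h. \<bar>h\<bar> \<le> r}" by simp
  qed
  finally show ?thesis .
qed

section \<open>Jumps of the sawtooth series\<close>

lemma powr_neg_mult_eq_power: "2 powr (- (real l * \<beta>)) = (2 powr - \<beta>) ^ l"
proof -
  have "(2 powr - \<beta>) ^ l = (2 powr - \<beta>) powr real l"
    by (rule powr_realpow[symmetric]) simp
  also have "\<dots> = 2 powr (- \<beta> * real l)"
    by (rule powr_powr)
  finally show ?thesis by (simp add: mult.commute)
qed

lemma half_power_powr:
  fixes \<beta> :: real
  shows "((1 / 2) ^ j) powr \<beta> = (2 powr - \<beta>) ^ j"
proof -
  have "(1 / 2 :: real) ^ j = 2 powr (- real j)"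
    by (simp add: powr_minus powr_realpow power_one_over inverse_eq_divide)
  then have "((1 / 2) ^ j) powr \<beta> = 2 powr (- real j * \<beta>)"
    by (simp only: powr_powr)
  then show ?thesis by (simp only: powr_neg_mult_eq_power mult_minus_left)
qed

lemma abs_sawtooth_le: "\<bar>sawtooth x\<bar> \<le> 1 / 2"
  unfolding sawtooth_def by linarith

lemma sawtooth_tendsto_right:
  "((\<lambda>x. sawtooth (2 ^ l * x)) \<longlongrightarrow> sawtooth (2 ^ l * d)) (at_right d)"
proof -
  have "((\<lambda>x. 2 ^ l * x - of_int \<lfloor>2 ^ l * d\<rfloor> - 1 / 2) \<longlongrightarrow> sawtooth (2 ^ l * d)) (at_right d)"
    unfolding sawtooth_def by (intro tendsto_intros)
  moreover have "eventually (\<lambda>x. 2 ^ l * x - of_int \<lfloor>2 ^ l * d\<rfloor> - 1 / 2 = sawtooth (2 ^ l * x)) (at_right d)"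
  proof (rule eventually_at_rightI)
    show "d < (of_int \<lfloor>2 ^ l * d\<rfloor> + 1) / 2 ^ l"
      using floor_correct[of "2 ^ l * d"] by (simp add: field_simps)
    fix x assume x: "x \<in> {d<..<(of_int \<lfloor>2 ^ l * d\<rfloor> + 1) / 2 ^ l}"
    have "2 ^ l * d \<le> 2 ^ l * x" using x by simp
    moreover have "2 ^ l * x < of_int \<lfloor>2 ^ l * d\<rfloor> + 1" using x by (simp add: field_simps)
    ultimately have "\<lfloor>2 ^ l * x\<rfloor> = \<lfloor>2 ^ l * d\<rfloor>" by linarith
    then show "2 ^ l * x - of_int \<lfloor>2 ^ l * d\<rfloor> - 1 / 2 = sawtooth (2 ^ l * x)"
      by (simp add: sawtooth_def)
  qed
  ultimately show ?thesis by (rule Lim_transform_eventually)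
qed

text \<open>Just left of \<open>d\<close> the floor is the ceiling at \<open>d\<close> minus 1,
  whether or not \<open>2 ^ l * d\<close> is an integer. The limit exceeds the value at
  \<open>d\<close> by 1 at integers and by 0 otherwise.\<close>

lemma sawtooth_tendsto_left:
  "((\<lambda>x. sawtooth (2 ^ l * x)) \<longlongrightarrow> 2 ^ l * d - of_int \<lceil>2 ^ l * d\<rceil> + 1 / 2) (at_left d)"
proof -
  have "((\<lambda>x. 2 ^ l * x - of_int \<lceil>2 ^ l * d\<rceil> + 1 / 2) \<longlongrightarrow> 2 ^ l * d - of_int \<lceil>2 ^ l * d\<rceil> + 1 / 2) (at_left d)"
    by (intro tendsto_intros)
  moreover have "eventually (\<lambda>x. 2 ^ l * x - of_int \<lceil>2 ^ l * d\<rceil> + 1 / 2 = sawtooth (2 ^ l * x)) (at_left d)"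
  proof (rule eventually_at_leftI)
    show "(of_int \<lceil>2 ^ l * d\<rceil> - 1) / 2 ^ l < d"
      using ceiling_correct[of "2 ^ l * d"] by (simp add: field_simps)
    fix x assume x: "x \<in> {(of_int \<lceil>2 ^ l * d\<rceil> - 1) / 2 ^ l<..<d}"
    have "2 ^ l * x < 2 ^ l * d" using x by simp
    moreover have "of_int \<lceil>2 ^ l * d\<rceil> - 1 < 2 ^ l * x" using x by (simp add: field_simps)
    ultimately have "\<lfloor>2 ^ l * x\<rfloor> = \<lceil>2 ^ l * d\<rceil> - 1" by linarith
    then show "2 ^ l * x - of_int \<lceil>2 ^ l * d\<rceil> + 1 / 2 = sawtooth (2 ^ l * x)"
      by (simp add: sawtooth_def)
  qed
  ultimately show ?thesis by (rule Lim_transform_eventually)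
qed

lemma f_saw_borel_measurable: "f_saw \<beta> \<in> borel_measurable borel"
proof -
  have "(\<lambda>x. \<Sum>l. 2 powr (- (real l * \<beta>)) * sawtooth (2 ^ l * x)) \<in> borel_measurable borel"
    unfolding sawtooth_def by measurable
  then show ?thesis by (simp only: f_saw_def[abs_def])
qed

context
  fixes \<beta> :: real
  assumes \<beta>: "\<beta> > 1"
begin

private definition "q = 2 powr - \<beta>"

text \<open>The bound \<open>2 * q < 1\<close> expresses \<beta> > 1; it keeps the slopes of the
  partial sums bounded.\<close>

private lemma q: "0 < q" "2 * q < 1" "q < 1"
proof -
  have "q < 2 powr - 1" unfolding q_def using \<beta> by (intro powr_less_mono) auto
  then show "2 * q < 1" by (simp add: powr_minus)
  show "0 < q" by (simp add: q_def)
  then show "q < 1" using \<open>2 * q < 1\<close> by linarith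
qed

private lemma f_saw_eq: "f_saw \<beta> x = (\<Sum>l. q ^ l * sawtooth (2 ^ l * x))"
  by (simp only: f_saw_def powr_neg_mult_eq_power q_def)

private lemma summable_weighted:
  assumes "\<And>l. \<bar>t l\<bar> \<le> (1 / 2 :: real)"
  shows "summable (\<lambda>l. q ^ l * t l)"
proof (rule summable_comparison_test')
  show "summable (\<lambda>l. q ^ l)" using q by (intro summable_geometric) auto
  show "norm (q ^ l * t l) \<le> q ^ l" for l
    using q assms[of l] by (auto simp: abs_mult intro!: mult_left_le)
qed

text \<open>Dominated convergence for series, with the geometric majorant \<open>q ^ l\<close>; it
  serves both one-sided limits.\<close>

private lemma f_saw_tendsto:
  assumes "\<And>l. ((\<lambda>x. sawtooth (2 ^ l * x)) \<longlongrightarrow> t l) F" "F \<noteq> bot"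
  shows "(f_saw \<beta> \<longlongrightarrow> (\<Sum>l. q ^ l * t l)) F"
proof -
  have "((\<lambda>x. \<Sum>l. q ^ l * sawtooth (2 ^ l * x)) \<longlongrightarrow> (\<Sum>l. q ^ l * t l)) F"
  proof (rule conjunct2[OF conjunct2[OF tannerys_theorem]])
    show "((\<lambda>x. q ^ l * sawtooth (2 ^ l * x)) \<longlongrightarrow> q ^ l * t l) F" for l
      by (intro tendsto_intros assms)
    have "norm (q ^ l * sawtooth (2 ^ l * x)) \<le> q ^ l" for l x
      using q abs_sawtooth_le[of "2 ^ l * x"] by (auto simp: abs_mult intro!: mult_left_le)
    then show "\<forall>\<^sub>F (l, x) in sequentially \<times>\<^sub>F F. norm (q ^ l * sawtooth (2 ^ l * x)) \<le> q ^ l"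
      by (intro always_eventually) auto
    show "summable (\<lambda>l. q ^ l)" using q by (intro summable_geometric) auto
    show "F \<noteq> bot" by fact
  qed
  then show ?thesis by (simp only: f_saw_eq[abs_def])
qed

text \<open>All terms jump in the same direction, so nothing cancels and the term of index
  \<open>j\<close> alone gives the bound.\<close>

private lemma f_saw_jump:
  assumes "2 ^ j * d \<in> \<int>"
  obtains L where "(f_saw \<beta> \<longlongrightarrow> L) (at_left d)" "q ^ j \<le> L - f_saw \<beta> d"
proof
  let ?t = "\<lambda>l. 2 ^ l * d - of_int \<lceil>2 ^ l * d\<rceil> + 1 / 2"
  let ?s = "\<lambda>l. sawtooth (2 ^ l * d)"
  show "(f_saw \<beta> \<longlongrightarrow> (\<Sum>l. q ^ l * ?t l)) (at_left d)"
    by (intro f_saw_tendsto sawtooth_tendsto_left) simp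
  have t: "\<bar>?t l\<bar> \<le> 1 / 2" for l by linarith
  have le: "?s l \<le> ?t l" for l
    unfolding sawtooth_def using ceiling_diff_floor_le_1[of "2 ^ l * d"] by linarith
  have sm: "summable (\<lambda>l. q ^ l * ?t l)" "summable (\<lambda>l. q ^ l * ?s l)"
    by (rule summable_weighted, (rule t abs_sawtooth_le))+
  \<comment> \<open>At an integer the left limit is 1/2 and the value is -1/2.\<close>
  have "q ^ j = q ^ j * ?t j - q ^ j * ?s j"
    using assms by (auto simp: sawtooth_def elim!: Ints_cases)
  also have "\<dots> = (\<Sum>l\<in>{j}. q ^ l * ?t l - q ^ l * ?s l)" by simp
  also have "\<dots> \<le> (\<Sum>l. q ^ l * ?t l - q ^ l * ?s l)"
    using le q by (intro sum_le_suminf summable_diff sm) (auto simp: mult_left_mono)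
  also have "\<dots> = (\<Sum>l. q ^ l * ?t l) - f_saw \<beta> d"
    using sm by (simp add: suminf_diff f_saw_eq)
  finally show "q ^ j \<le> (\<Sum>l. q ^ l * ?t l) - f_saw \<beta> d" .
qed

private lemma SUP_f_saw_ge:
  assumes "2 ^ j * d \<in> \<int>" "\<bar>d - x0\<bar> < r" "n > 0"
  shows "ennreal (q ^ j / 2) \<le>
    (SUP h\<in>{h. \<bar>h\<bar> \<le> r}. Linfty_norm (diff_dom n h x0 r) (fin_diff n h (f_saw \<beta>)))"
proof -
  obtain L where L: "(f_saw \<beta> \<longlongrightarrow> L) (at_left d)" "q ^ j \<le> L - f_saw \<beta> d"
    using f_saw_jump[OF assms(1)] .
  have "(f_saw \<beta> \<longlongrightarrow> f_saw \<beta> d) (at_right d)"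
    unfolding f_saw_eq[of d] by (intro f_saw_tendsto sawtooth_tendsto_right) simp
  \<comment> \<open>Halving supplies the strict inequality that the jump estimate requires.\<close>
  moreover have "q ^ j / 2 < \<bar>L - f_saw \<beta> d\<bar>"
    using L(2) zero_less_power[OF q(1), of j] by linarith
  ultimately show ?thesis using assms L(1) by (intro jump_le_SUP_Linfty_norm)
qed

section \<open>Irregularity from jumps\<close>

lemma irregular_f_saw_dyadic:
  assumes "dyadic_rational x0"
  shows "irregular_at 0 x0 (f_saw \<beta>)"
proof -
  obtain k j where kj: "x0 = of_int k / 2 ^ j" using assms by (auto simp: dyadic_rational_def)
  have int: "2 ^ j * x0 \<in> \<int>" by (simp add: kj)
  \<comment> \<open>The jump at \<open>x0\<close> lies in every ball, so the bound does not depend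
    on \<open>r\<close>; \<open>r powr 0\<close> is 1 because \<open>r > 0\<close>.\<close>
  have lower: "ennreal (q ^ j / 2 * r powr 0) \<le>
    (SUP h\<in>{h. \<bar>h\<bar> \<le> r}. Linfty_norm (diff_dom n h x0 r) (fin_diff n h (f_saw \<beta>)))"
    if "0 < r" "n > 0" for r n
    using SUP_f_saw_ge[OF int, of x0 r n] that by simp
  have "q ^ j / 2 > 0" using q by simp
  then show ?thesis unfolding irregular_at_def Let_def
    by (intro exI[of _ "q ^ j / 2"] exI[of _ "1::real"] conjI allI impI lower) simp_all
qed

lemma irregular_f_saw_exponent: "irregular_at \<beta> x0 (f_saw \<beta>)"
proof -
  define n where "n = nat \<lfloor>\<beta>\<rfloor> + 1"
  have "ennreal (q / 2 * r powr \<beta>) \<le>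
    (SUP h\<in>{h. \<bar>h\<bar> \<le> r}. Linfty_norm (diff_dom n h x0 r) (fin_diff n h (f_saw \<beta>)))"
    if r: "0 < r" "r \<le> 1" for r
  proof -
    have "\<exists>j. (1 / 2) ^ j < r" using r by (intro real_arch_pow_inv) auto
    \<comment> \<open>The coarsest dyadic mesh below \<open>r\<close>; minimality makes
      \<open>r\<close> at most twice that mesh.\<close>
    define j where "j = (LEAST j. (1 / 2) ^ j < r)"
    have j: "(1 / 2) ^ j < r" unfolding j_def by (rule LeastI_ex) fact
    then obtain i where i: "j = Suc i" using r by (cases j) auto
    have "\<not> (1 / 2) ^ i < r" using not_less_Least[of i "\<lambda>j. (1 / 2) ^ j < r"] i by (simp add: j_def)
    then have r2: "r \<le> (1 / 2) ^ i" by simp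
    \<comment> \<open>The last point of the mesh not exceeding \<open>x0\<close>.\<close>
    define d where "d = of_int \<lfloor>2 ^ j * x0\<rfloor> / (2 ^ j :: real)"
    have "\<bar>2 ^ j * d - 2 ^ j * x0\<bar> \<le> 1" unfolding d_def by simp linarith
    then have "2 ^ j * \<bar>d - x0\<bar> \<le> 1"
      by (simp add: abs_mult right_diff_distrib[symmetric])
    then have "\<bar>d - x0\<bar> \<le> (1 / 2) ^ j" by (simp add: power_divide field_simps)
    then have d: "\<bar>d - x0\<bar> < r" using j by linarith
    have "r powr \<beta> \<le> ((1 / 2) ^ i) powr \<beta>" using r r2 \<beta> by (intro powr_mono2) auto
    also have "\<dots> = q ^ i"
      unfolding q_def by (rule half_power_powr)
    finally have "q / 2 * r powr \<beta> \<le> q / 2 * q ^ i" using q by (intro mult_left_mono) auto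
    \<comment> \<open>The factor \<open>q\<close> in the constant pays for passing from index
      \<open>i\<close> to \<open>j\<close>.\<close>
    then have "ennreal (q / 2 * r powr \<beta>) \<le> ennreal (q ^ j / 2)"
      by (intro ennreal_leI) (simp add: i)
    also have "\<dots> \<le> (SUP h\<in>{h. \<bar>h\<bar> \<le> r}. Linfty_norm (diff_dom n h x0 r) (fin_diff n h (f_saw \<beta>)))"
      by (rule SUP_f_saw_ge[OF _ d]) (auto simp: d_def n_def)
    finally show ?thesis .
  qed
  then show ?thesis unfolding irregular_at_def Let_def n_def[symmetric]
    using q by (intro exI[of _ "q / 2"] exI[of _ "1::real"] conjI allI impI) simp_all
qed

section \<open>Good scales at a non-dyadic point\<close>

text \<open>On this ball \<open>2 ^ j * x\<close> moves by less than 1/4 and crosses no integer.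
  Breakpoints of the coarser terms are also breakpoints at level \<open>j\<close>, so all terms up
  to \<open>j\<close> are affine there, with slopes \<open>(2 * q) ^ l\<close>; the rest is a
  geometric tail.\<close>

private lemma f_saw_near_affine:
  assumes far: "\<And>m::int. 1 / 4 \<le> \<bar>2 ^ j * x0 - of_int m\<bar>"
  obtains a b where "0 \<le> a" "a \<le> 1 / (1 - 2 * q)"
    "\<And>x. \<bar>x - x0\<bar> < (1 / 2) ^ j / 4 \<Longrightarrow> \<bar>f_saw \<beta> x - (a * x + b)\<bar> \<le> q ^ j / (1 - q)"
proof
  define a where "a = (\<Sum>l<Suc j. (2 * q) ^ l)"
  define b where "b = (\<Sum>l<Suc j. - (q ^ l * (of_int \<lfloor>2 ^ l * x0\<rfloor> + 1 / 2)))"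
  show "0 \<le> a" unfolding a_def using q by (intro sum_nonneg) auto
  have "a \<le> (\<Sum>l. (2 * q) ^ l)"
    unfolding a_def using q by (intro sum_le_suminf summable_geometric) auto
  also have "\<dots> = 1 / (1 - 2 * q)" using q by (intro suminf_geometric) auto
  finally show "a \<le> 1 / (1 - 2 * q)" .
  fix x assume x: "\<bar>x - x0\<bar> < (1 / 2) ^ j / 4"
  have "\<bar>2 ^ j * x - 2 ^ j * x0\<bar> = 2 ^ j * \<bar>x - x0\<bar>"
    by (simp add: abs_mult flip: right_diff_distrib)
  also have "\<dots> < 2 ^ j * ((1 / 2) ^ j / 4)" using x by (intro mult_strict_left_mono) auto
  also have "\<dots> = 1 / 4" by (simp add: power_divide)
  finally have near: "\<bar>2 ^ j * x - 2 ^ j * x0\<bar> < 1 / 4" .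
  have floor_eq: "\<lfloor>2 ^ l * x\<rfloor> = \<lfloor>2 ^ l * x0\<rfloor>" if "l \<le> j" for l
  proof -
    \<comment> \<open>Floors agree once the same integers lie below; an integer \<open>m\<close> at
      level \<open>l\<close> becomes \<open>2 ^ (j - l) * m\<close> at level
      \<open>j\<close>.\<close>
    have "of_int m \<le> 2 ^ l * x \<longleftrightarrow> of_int m \<le> 2 ^ l * x0" for m :: int
    proof -
      have scale: "of_int m \<le> 2 ^ l * y \<longleftrightarrow> of_int (2 ^ (j - l) * m) \<le> 2 ^ j * y" for y :: real
      proof -
        have "(2::real) ^ j = 2 ^ (j - l) * 2 ^ l" using that by (simp flip: power_add)
        then show ?thesis by (simp add: mult.assoc)
      qed
      show ?thesis unfolding scale using near far[of "2 ^ (j - l) * m"] by linarith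
    qed
    then show ?thesis by (metis le_floor_iff order_antisym order_refl)
  qed
  let ?s = "\<lambda>l. sawtooth (2 ^ l * x)"
  have sm: "summable (\<lambda>l. q ^ l * ?s l)" by (rule summable_weighted) (rule abs_sawtooth_le)
  have "(\<Sum>l<Suc j. q ^ l * ?s l) = a * x + b"
    unfolding a_def b_def sum_distrib_right sum.distrib[symmetric]
  proof (rule sum.cong)
    fix l assume "l \<in> {..<Suc j}"
    then have "\<lfloor>2 ^ l * x\<rfloor> = \<lfloor>2 ^ l * x0\<rfloor>" using floor_eq by simp
    then show "q ^ l * ?s l = (2 * q) ^ l * x + - (q ^ l * (of_int \<lfloor>2 ^ l * x0\<rfloor> + 1 / 2))"
      unfolding sawtooth_def power_mult_distrib by (simp only:) (simp add: algebra_simps)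
  qed simp
  then have eq: "f_saw \<beta> x - (a * x + b) = (\<Sum>l. q ^ (l + Suc j) * ?s (l + Suc j))"
    unfolding f_saw_eq using suminf_split_initial_segment[OF sm, of "Suc j"] by simp
  have "norm (q ^ (l + Suc j) * ?s (l + Suc j)) \<le> q ^ j * q ^ l" for l
  proof -
    have "norm (q ^ (l + Suc j) * ?s (l + Suc j)) \<le> q ^ (l + Suc j)"
      using q abs_sawtooth_le[of "2 ^ (l + Suc j) * x"]
      by (auto simp: abs_mult simp del: power_Suc add_Suc_right intro!: mult_left_le)
    also have "\<dots> \<le> q ^ (l + j)" using q by (intro power_decreasing) auto
    finally show ?thesis by (simp add: power_add mult.commute)
  qed
  then have "norm (\<Sum>l. q ^ (l + Suc j) * ?s (l + Suc j)) \<le> (\<Sum>l. q ^ j * q ^ l)"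
    using q by (intro norm_suminf_le summable_mult summable_geometric) auto
  also have "\<dots> = q ^ j / (1 - q)"
    using q by (simp add: suminf_mult suminf_geometric summable_geometric)
  finally show "\<bar>f_saw \<beta> x - (a * x + b)\<bar> \<le> q ^ j / (1 - q)" by (simp add: eq)
qed

private lemma SUP_f_saw_le:
  assumes far: "\<And>m::int. 1 / 4 \<le> \<bar>2 ^ j * x0 - of_int m\<bar>" and r: "r = (1 / 2) ^ j / 4"
  shows "(SUP h\<in>{h. \<bar>h\<bar> \<le> r}. Linfty_norm (diff_dom (Suc n) h x0 r) (fin_diff (Suc n) h (f_saw \<beta>)))
    \<le> ennreal (2 ^ Suc n * (4 powr \<beta> * r powr \<beta> / (1 - q)) + (if n = 0 then r / (1 - 2 * q) else 0))"
proof (rule SUP_least, rule Linfty_norm_le)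
  obtain a b where ab: "0 \<le> a" "a \<le> 1 / (1 - 2 * q)"
    "\<And>x. \<bar>x - x0\<bar> < (1 / 2) ^ j / 4 \<Longrightarrow> \<bar>f_saw \<beta> x - (a * x + b)\<bar> \<le> q ^ j / (1 - q)"
    using f_saw_near_affine[OF far] by blast
  fix h assume h: "h \<in> {h. \<bar>h\<bar> \<le> r}"
  show "fin_diff (Suc n) h (f_saw \<beta>) \<in> borel_measurable borel"
    by (intro fin_diff_borel_measurable f_saw_borel_measurable)
  fix x assume x: "x \<in> diff_dom (Suc n) h x0 r"
  \<comment> \<open>The radius is a quarter of \<open>(1 / 2) ^ j\<close>, which produces the factor
    \<open>4 powr \<beta>\<close>.\<close>
  have "q ^ j = (4 * r) powr \<beta>"
    by (simp add: q_def r flip: half_power_powr)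
  also have "\<dots> = 4 powr \<beta> * r powr \<beta>" by (rule powr_mult)
  finally have qj: "q ^ j = 4 powr \<beta> * r powr \<beta>" .
  have "\<bar>fin_diff (Suc n) h (f_saw \<beta>) x - fin_diff (Suc n) h (\<lambda>x. a * x + b) x\<bar>
      \<le> 2 ^ Suc n * (q ^ j / (1 - q))"
  proof (rule fin_diff_close)
    fix i assume "i \<le> Suc n"
    from diff_dom_node[OF x this]
    show "\<bar>f_saw \<beta> (x + real i * h) - (a * (x + real i * h) + b)\<bar> \<le> q ^ j / (1 - q)"
      by (intro ab(3)) (simp add: r)
  qed
  moreover have "\<bar>fin_diff (Suc n) h (\<lambda>x. a * x + b) x\<bar> \<le> (if n = 0 then r / (1 - 2 * q) else 0)"
  proof -
    have "\<bar>a * h\<bar> \<le> 1 / (1 - 2 * q) * r"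
      unfolding abs_mult using ab h q by (intro mult_mono) auto
    then show ?thesis by (simp add: fin_diff_affine del: fin_diff.simps)
  qed
  moreover have "\<bar>y\<bar> \<le> u + v" if "\<bar>y - z\<bar> \<le> u" "\<bar>z\<bar> \<le> v" for y z u v :: real
    using that by linarith
  ultimately show "\<bar>fin_diff (Suc n) h (f_saw \<beta>) x\<bar>
      \<le> 2 ^ Suc n * (4 powr \<beta> * r powr \<beta> / (1 - q)) + (if n = 0 then r / (1 - 2 * q) else 0)"
    unfolding qj by blast
qed

text \<open>If \<open>2 ^ j * x0\<close> stayed within \<open>1/4\<close> of an integer for all \<open>j \<ge> N\<close>, then the nearest integer
  would double at every step and so would the distance to it, which must therefore vanish.\<close>

private lemma nondyadic_far_from_ints:
  assumes "\<not> dyadic_rational x0"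
  shows "\<exists>j\<ge>N. \<forall>m::int. 1 / 4 \<le> \<bar>2 ^ j * x0 - of_int m\<bar>"
proof (rule ccontr)
  assume "\<not> ?thesis"
  then have close: "\<exists>m::int. \<bar>2 ^ j * x0 - of_int m\<bar> < 1 / 4" if "N \<le> j" for j
    using that by (meson not_le)
  obtain m :: int where m: "\<bar>2 ^ N * x0 - of_int m\<bar> < 1 / 4" using close by blast
  have *: "\<bar>2 ^ (N + k) * x0 - of_int (2 ^ k * m)\<bar> < 1 / 4" for k
  proof (induction k)
    case 0
    then show ?case using m by simp
  next
    case (Suc k)
    obtain m' :: int where m': "\<bar>2 ^ (N + Suc k) * x0 - of_int m'\<bar> < 1 / 4"
      using close[of "N + Suc k"] by auto
    have "\<bar>2 ^ (N + Suc k) * x0 - of_int (2 ^ Suc k * m)\<bar> < 1 / 2"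
    proof -
      have eq: "2 ^ (N + Suc k) * x0 - of_int (2 ^ Suc k * m) = 2 * (2 ^ (N + k) * x0 - of_int (2 ^ k * m))"
        by (simp add: algebra_simps)
      have "\<bar>2 * y\<bar> < 1 / 2" if "\<bar>y\<bar> < 1 / 4" for y :: real
        using that by linarith
      then show ?thesis unfolding eq using Suc.IH by blast
    qed
    \<comment> \<open>Two integers at distance below 1/4 + 1/2 coincide.\<close>
    with m' have "m' = 2 ^ Suc k * m" by linarith
    with m' show ?case by simp
  qed
  have "2 ^ N * x0 - of_int m = 0"
  proof (rule ccontr)
    assume "2 ^ N * x0 - of_int m \<noteq> 0"
    then obtain k where k: "1 < 2 ^ k * \<bar>2 ^ N * x0 - of_int m\<bar>"
      using real_arch_pow[of 2 "1 / \<bar>2 ^ N * x0 - of_int m\<bar>"] by (auto simp: field_simps)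
    also have "2 ^ k * \<bar>2 ^ N * x0 - of_int m\<bar> = \<bar>2 ^ k * (2 ^ N * x0 - of_int m)\<bar>"
      by (simp add: abs_mult)
    also have "\<dots> = \<bar>2 ^ (N + k) * x0 - of_int (2 ^ k * m)\<bar>"
      by (simp add: power_add algebra_simps)
    also have "\<dots> < 1 / 4" by (rule *)
    finally show False by simp
  qed
  then have "x0 = of_int m / 2 ^ N" by (simp add: field_simps)
  then show False using assms by (auto simp: dyadic_rational_def)
qed

text \<open>Irregularity demands its lower bound at every small radius, so arbitrarily small good
  scales suffice to refute it.\<close>

lemma not_irregular_f_saw:
  assumes "\<not> dyadic_rational x0" "0 \<le> \<alpha>" "\<alpha> < \<beta>"
  shows "\<not> irregular_at \<alpha> x0 (f_saw \<beta>)"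
proof
  assume "irregular_at \<alpha> x0 (f_saw \<beta>)"
  define n where "n = nat \<lfloor>\<alpha>\<rfloor>"
  define K where "K = 2 ^ Suc n * 4 powr \<beta> / (1 - q)"
  \<comment> \<open>\<open>A\<close> is nonzero only when \<alpha> < 1, so
    \<open>A * r powr (1 - \<alpha>)\<close> tends to 0 in every case.\<close>
  define A where "A = (if n = 0 then 1 / (1 - 2 * q) else 0)"
  have KA: "0 \<le> K" "0 \<le> A" using q by (auto simp: K_def A_def)
  obtain C R where CR: "C > 0" "R > 0" and lower: "\<And>r. 0 < r \<Longrightarrow> r \<le> R \<Longrightarrow> ennreal (C * r powr \<alpha>) \<le>
      (SUP h\<in>{h. \<bar>h\<bar> \<le> r}. Linfty_norm (diff_dom (Suc n) h x0 r) (fin_diff (Suc n) h (f_saw \<beta>)))"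
    using \<open>irregular_at \<alpha> x0 (f_saw \<beta>)\<close> unfolding irregular_at_def Let_def n_def by auto
  have "((\<lambda>r. K * r powr (\<beta> - \<alpha>) + A * r powr (1 - \<alpha>)) \<longlongrightarrow> 0) (at_right 0)"
  proof -
    have lim: "((\<lambda>r. r powr e) \<longlongrightarrow> 0) (at_right (0::real))" if "e > 0" for e :: real
      using that by (intro tendsto_zero_powrI[where b = e] tendsto_intros)
        (auto simp: eventually_at_right_less order.strict_implies_order
          intro!: eventually_at_rightI[of 0 1])
    have "((\<lambda>r. A * r powr (1 - \<alpha>)) \<longlongrightarrow> 0) (at_right 0)"
    proof (cases "n = 0")
      case True
      then have "\<alpha> < 1" using assms unfolding n_def by linarith
      then show ?thesis using tendsto_mult_left[OF lim[of "1 - \<alpha>"], of A] by simp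
    qed (simp add: A_def)
    moreover have "((\<lambda>r. K * r powr (\<beta> - \<alpha>)) \<longlongrightarrow> 0) (at_right 0)"
      using tendsto_mult_left[OF lim[of "\<beta> - \<alpha>"], of K] assms by simp
    ultimately show ?thesis using tendsto_add by fastforce
  qed
  then have "eventually (\<lambda>r. K * r powr (\<beta> - \<alpha>) + A * r powr (1 - \<alpha>) < C) (at_right 0)"
    using CR by (intro order_tendstoD)
  then obtain \<delta> where \<delta>: "\<delta> > 0"
    "\<And>r. 0 < r \<Longrightarrow> r < \<delta> \<Longrightarrow> K * r powr (\<beta> - \<alpha>) + A * r powr (1 - \<alpha>) < C"
    unfolding eventually_at_right_field by auto
  obtain N where N: "(1 / 2) ^ N < min \<delta> R"
    using real_arch_pow_inv[of "min \<delta> R" "1 / 2"] \<delta>(1) CR(2) by auto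
  obtain j where j: "N \<le> j" "\<And>m::int. 1 / 4 \<le> \<bar>2 ^ j * x0 - of_int m\<bar>"
    using nondyadic_far_from_ints[OF assms(1), of N] by blast
  define r where "r = (1 / 2 :: real) ^ j / 4"
  have "(1 / 2 :: real) ^ j \<le> (1 / 2) ^ N" using j(1) by (intro power_decreasing) auto
  moreover have "(1 / 2 :: real) ^ j > 0" by simp
  ultimately have r: "0 < r" "r < \<delta>" "r \<le> R" using N unfolding r_def by linarith+
  have "ennreal (C * r powr \<alpha>) \<le> ennreal (K * r powr \<beta> + A * r)"
    using order_trans[OF lower[OF r(1,3)] SUP_f_saw_le[OF j(2) r_def]]
    by (auto simp: K_def A_def mult.assoc split: if_splits)
  \<comment> \<open>\<open>ennreal\<close> truncates negative numbers to 0, so the comparison of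
    reals needs this sign.\<close>
  moreover have "0 \<le> K * r powr \<beta> + A * r" using KA r by simp
  ultimately have "C * r powr \<alpha> \<le> K * r powr \<beta> + A * r" by simp
  also have "\<dots> = (K * r powr (\<beta> - \<alpha>) + A * r powr (1 - \<alpha>)) * r powr \<alpha>"
    using r by (simp add: distrib_right mult.assoc flip: powr_add)
  also have "\<dots> < C * r powr \<alpha>" using \<delta>(2)[OF r(1,2)] r by (intro mult_strict_right_mono) auto
  finally show False by simp
qed

end

section \<open>Upper Hoelder exponents\<close>

lemma upper_Holder_exponent_f_saw:
  assumes "\<beta> > 1"
  shows "upper_Holder_exponent (f_saw \<beta>) x0 = (if dyadic_rational x0 then 0 else ereal \<beta>)"
proof (cases "dyadic_rational x0")
  case True
  then have "irregular_at 0 x0 (f_saw \<beta>)"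
    by (rule irregular_f_saw_dyadic[OF assms])
  then have "upper_Holder_exponent (f_saw \<beta>) x0 = 0"
    unfolding upper_Holder_exponent_def
    by (intro antisym INF_greatest INF_lower2[of 0]) auto
  then show ?thesis using True by simp
next
  case False
  then have "\<beta> \<le> \<alpha>" if "0 \<le> \<alpha>" "irregular_at \<alpha> x0 (f_saw \<beta>)" for \<alpha>
    using not_irregular_f_saw[OF assms, of x0 \<alpha>] that by fastforce
  moreover have "irregular_at \<beta> x0 (f_saw \<beta>)"
    using assms by (rule irregular_f_saw_exponent)
  \<comment> \<open>The infimum is attained: \<beta> is admissible and nothing smaller is.\<close>
  ultimately have "upper_Holder_exponent (f_saw \<beta>) x0 = ereal \<beta>"
    unfolding upper_Holder_exponent_def using assms
    by (intro antisym INF_greatest INF_lower2[of \<beta>]) auto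
  then show ?thesis using False by simp
qed

theorem theorem9:
  fixes \<beta> x0 :: real
  assumes "\<beta> > 1"
  shows "(\<not> dyadic_rational x0 \<longrightarrow> upper_Holder_exponent (f_saw \<beta>) x0 = ereal \<beta>) \<and>
         (dyadic_rational x0 \<longrightarrow> upper_Holder_exponent (f_saw \<beta>) x0 = 0)"
  by (simp add: upper_Holder_exponent_f_saw[OF assms])

end
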